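(* Let $k\in\mathbb{N}$ be fixed and let $(b_n)_{n\in\mathbb{N}}$ be the increasing sequence of all positive integers that are products of exactly $k$ distinct primes. Let $\varepsilon>0$ be fixed and let $f$ be any real-valued function on $\mathbb{N}$ satisfying $$f(N) = o\left(N^{1/(2k+1)-\varepsilon}\right)\qquad (N\to\infty).$$ Then, for every $\tau\in\mathbb{R}$ and for all sufficiently large $N$ depending on $\tau$, we have $$\mathfrak{m}_N(\tau) < \exp(-f(N)).$$
   Context: $\mathbb{N}=\{1,2,3,\dots\}$. For $N\in\mathbb{N}$ and $\tau\in\mathbb{R}$, $$\mathfrak{m}_N(\tau) = \min\Bigl\{ \Bigl|\sum_{n=1}^N \frac{s_n}{b_n} - \tau\Bigr| : s_n\in\{-1,1\} \text{ for } n=1,\dots,N\Bigr\}.$$ "Sufficiently large" may also depend on the fixed data $k$, $\varepsilon$ and $f$. *)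

theory Defs
  imports
    Complex_Main
    "HOL-Library.FuncSet"
    "HOL-Library.Infinite_Set"
    "HOL-Library.Landau_Symbols"
    "HOL-Computational_Algebra.Primes"
begin

definition prime_products :: "nat \<Rightarrow> nat set" where
  "prime_products k = {m. \<exists>P. finite P \<and> card P = k \<and> (\<forall>p\<in>P. prime p) \<and> m = \<Prod>P}"

text \<open>
  The sequence is indexed from 1, whereas \<open>enumerate\<close> lists an infinite set
  increasingly from index 0. The value at index 0 is junk and never used.
\<close>

definition bseq :: "nat \<Rightarrow> nat \<Rightarrow> nat" where
  "bseq k n = enumerate (prime_products k) (n - 1)"

text \<open>
  The sign vectors are extensional functions on \<open>{1..N}\<close>, so the minimum is taken over
  the image of a finite nonempty set.
\<close>

definition min_signed_dist :: "(nat \<Rightarrow> nat) \<Rightarrow> nat \<Rightarrow> real \<Rightarrow> real" where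
  "min_signed_dist b N \<tau> =
     Min ((\<lambda>s. \<bar>(\<Sum>n=1..N. s n / real (b n)) - \<tau>\<bar>) ` ({1..N} \<rightarrow>\<^sub>E {-1, 1 :: real}))"

end

(*
  Only the terms b = Q p matter, with Q a fixed product of k - 1 primes and p a prime up to
  R = (N - 1) div Q; these all occur among the first N terms because the N-th term is at least N - 1.

  Coarse step: greedy signs on all terms except Q p with R^(3/4) < p <= R bring the error down to
  about R^(-2/3). Greedy choice works since every remaining reciprocal is dominated by the sum of the
  smaller ones, by Chebyshev's lower bound and the divergence of the sum of 1/p.

  Fine step: let Z range over the signed sums of 1/p for R^(3/4) < p <= R. The average of
  cos (x (Z - t)) over the signs is cos (x t) times the product of cos (x/p). Integrated against the
  Fejer weight 1 - x/T on [0, T], each single cosine contributes at most 2 / (T |Z - t|^2), which is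
  tiny if no Z is near t. The averaged integrand however is positive for x up to X ~ R^(2/3), as
  long as |t| <= 1/X, and for X <= x <= T it is negligible: if sin (x/p) is small then p divides
  one of few integers near x/pi, and each of those has at most log T prime factors in the range. So
  |sin (x/p)| is at least about 1 / log T for most p, and the product of the cosines is at most
  exp (-c R^(1-o(1)) / (log T)^2), which beats 1/T for log T up to about R^(1/3).
*)
theory Submission
  imports Defs "HOL-Analysis.Analysis" "HOL-Real_Asymp.Real_Asymp"
begin

section \<open>Fourier analysis of signed sums of prime reciprocals\<close>

text \<open>The integral equals \<open>(1 - cos (T * u)) / (T * u\<^sup>2)\<close>: the weight
  vanishes at \<open>T\<close>, so no boundary sine term of order \<open>1 / u\<close>
  survives.\<close>

lemma integral_fejer_cos_le:
  fixes T u d :: real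
  assumes "T > 0" "d > 0" "d \<le> \<bar>u\<bar>"
  shows "integral {0..T} (\<lambda>x. (1 - x / T) * cos (x * u)) \<le> 2 / (T * d\<^sup>2)"
proof -
  have u: "u \<noteq> 0" using assms by auto
  let ?F = "\<lambda>x. (1 - x / T) * sin (x * u) / u - cos (x * u) / (T * u\<^sup>2)"
  have "((\<lambda>x. (1 - x / T) * cos (x * u)) has_integral (?F T - ?F 0)) {0..T}"
  proof (rule fundamental_theorem_of_calculus)
    fix x
    show "(?F has_vector_derivative (1 - x / T) * cos (x * u)) (at x within {0..T})"
      unfolding has_real_derivative_iff_has_vector_derivative[symmetric]
      using u assms(1)
      by (auto intro!: derivative_eq_intros simp: field_simps power2_eq_square)
  qed (use assms in auto)
  hence "integral {0..T} (\<lambda>x. (1 - x / T) * cos (x * u)) = ?F T - ?F 0"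
    by (rule integral_unique)
  also have "\<dots> = (1 - cos (T * u)) / (T * u\<^sup>2)"
    using assms(1) by (simp add: diff_divide_distrib)
  also have "\<dots> \<le> 2 / (T * u\<^sup>2)"
    using assms(1) cos_ge_minus_one[of "T * u"] by (intro divide_right_mono) auto
  also have "\<dots> \<le> 2 / (T * d\<^sup>2)"
    using assms u by (intro divide_left_mono mult_left_mono) (auto simp: abs_le_square_iff[symmetric])
  finally show ?thesis .
qed

text \<open>By the product formula, each factor \<open>cos (x * v q)\<close> replaces
  \<open>cos (x * t)\<close> by the mean of two cosines with \<open>t\<close> shifted by
  \<open>v q\<close> either way. The integral is thus a mean over all sign choices of integrals
  bounded by \<open>K\<close>. The induction needs \<open>t\<close> arbitrary because of these
  shifts.\<close>

lemma integral_prod_cos_le: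
  fixes v :: "'a \<Rightarrow> real"
  assumes "finite P"
    and "\<And>s. (\<forall>p\<in>P. s p \<in> {-1, 1}) \<Longrightarrow>
      integral {0..T} (\<lambda>x. (1 - x / T) * cos (x * ((\<Sum>p\<in>P. s p * v p) - t))) \<le> K"
  shows "integral {0..T} (\<lambda>x. (1 - x / T) * ((\<Prod>p\<in>P. cos (x * v p)) * cos (x * t))) \<le> K"
  using assms
proof (induction P arbitrary: t rule: finite_induct)
  case empty
  show ?case using empty(1)[of "\<lambda>_. 1"] by simp
next
  case (insert q P)
  let ?I = "\<lambda>t. integral {0..T} (\<lambda>x. (1 - x / T) * ((\<Prod>p\<in>P. cos (x * v p)) * cos (x * t)))"
  have *: "?I (t - e * v q) \<le> K" if e: "e \<in> {-1, 1}" for e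
  proof (rule insert.IH)
    fix s :: "'a \<Rightarrow> real" assume s: "\<forall>p\<in>P. s p \<in> {-1, 1}"
    have "(\<Sum>p\<in>P. (s(q := e)) p * v p) = (\<Sum>p\<in>P. s p * v p)"
      using insert.hyps by (intro sum.cong) auto
    hence "(\<Sum>p\<in>insert q P. (s(q := e)) p * v p) = (\<Sum>p\<in>P. s p * v p) + e * v q"
      using insert.hyps by simp
    moreover have "\<forall>p\<in>insert q P. (s(q := e)) p \<in> {-1, 1}" using s e by auto
    ultimately show "integral {0..T} (\<lambda>x. (1 - x / T) *
        cos (x * ((\<Sum>p\<in>P. s p * v p) - (t - e * v q)))) \<le> K"
      using insert.prems[of "s(q := e)"] by (simp add: algebra_simps)
  qed
  have int: "(\<lambda>x. (1 - x / T) * ((\<Prod>p\<in>P. cos (x * v p)) * cos (x * t))) integrable_on {0..T}" for t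
    unfolding divide_inverse by (intro integrable_continuous_real continuous_intros)
  have "(\<lambda>x. (1 - x / T) * ((\<Prod>p\<in>insert q P. cos (x * v p)) * cos (x * t))) =
    (\<lambda>x. (1 / 2) * ((1 - x / T) * ((\<Prod>p\<in>P. cos (x * v p)) * cos (x * (t - 1 * v q))) +
       (1 - x / T) * ((\<Prod>p\<in>P. cos (x * v p)) * cos (x * (t - (-1) * v q)))))"
    using insert.hyps by (auto simp: algebra_simps cos_add cos_diff)
  hence "integral {0..T} (\<lambda>x. (1 - x / T) * ((\<Prod>p\<in>insert q P. cos (x * v p)) * cos (x * t)))
      = (1 / 2) * (?I (t - 1 * v q) + ?I (t - (-1) * v q))"
    by (simp only: integral_mult_right Henstock_Kurzweil_Integration.integral_add[OF int int])
  also have "\<dots> \<le> K" using *[of 1] *[of "-1"] by simp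
  finally show ?case .
qed

section \<open>Products of cosines at reciprocals of primes\<close>

lemma abs_le_two_abs_sin:
  fixes v :: real
  assumes "\<bar>v\<bar> \<le> pi / 2"
  shows "\<bar>v\<bar> \<le> 2 * \<bar>sin v\<bar>"
proof -
  have "\<bar>sin v - (\<Sum>m<3. sin_coeff m * v ^ m)\<bar> \<le> inverse (fact 3) * \<bar>v\<bar> ^ 3"
    by (rule Maclaurin_sin_bound)
  hence "\<bar>sin v - v\<bar> \<le> \<bar>v\<bar> * (v\<^sup>2 / 6)"
    by (simp add: eval_nat_numeral sin_coeff_def field_simps)
  also have "\<dots> \<le> \<bar>v\<bar> * (1 / 2)"
  proof (intro mult_left_mono)
    have "\<bar>v\<bar> \<le> 1.6" using assms pi_approx by simp
    hence "\<bar>v\<bar>\<^sup>2 \<le> 1.6\<^sup>2" by (intro power_mono) auto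
    thus "v\<^sup>2 / 6 \<le> 1 / 2" by (simp add: power2_eq_square)
  qed auto
  finally show ?thesis by linarith
qed

text \<open>Rounding \<open>u / pi\<close> moves \<open>u\<close> by a multiple of pi into the range
  where sine is comparable to its argument, and \<open>\<bar>sin u\<bar>\<close> has period
  pi.\<close>

lemma near_multiple_of_pi:
  fixes u :: real
  shows "\<exists>m::int. \<bar>u - pi * m\<bar> \<le> 2 * \<bar>sin u\<bar>"
proof
  let ?m = "round (u / pi)"
  have "\<bar>of_int ?m - u / pi\<bar> \<le> 1 / 2" by (rule of_int_round_abs_le)
  hence "\<bar>(of_int ?m - u / pi) * pi\<bar> \<le> pi / 2"
    by (simp add: abs_mult)
  hence "\<bar>u - pi * ?m\<bar> \<le> pi / 2" by (simp add: algebra_simps abs_minus_commute)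
  hence "\<bar>u - pi * ?m\<bar> \<le> 2 * \<bar>sin (u - pi * ?m)\<bar>" by (rule abs_le_two_abs_sin)
  also have "\<bar>sin (u - pi * ?m)\<bar> = \<bar>sin u\<bar>"
  proof -
    have "cos (pi * real_of_int ?m) ^ 2 = 1"
      using sin_cos_squared_add[of "pi * real_of_int ?m"] by (simp add: sin_integer_2pi mult.commute sin_zero_iff_int2)
    hence "\<bar>cos (pi * real_of_int ?m)\<bar> = 1" by (simp add: power2_eq_1_iff abs_if) 
    moreover have "sin (pi * real_of_int ?m) = 0" by (auto simp: sin_zero_iff_int2)
    ultimately show ?thesis by (simp add: sin_diff abs_mult)
  qed
  finally show "\<bar>u - pi * ?m\<bar> \<le> 2 * \<bar>sin u\<bar>" .
qed

text \<open>The product of the primes counted is at most \<open>a\<close>, and each of them is at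
  least e.\<close>

lemma card_prime_divisors_le:
  fixes P :: "nat set" and a :: nat and y :: real
  assumes "finite P" "\<And>p. p \<in> P \<Longrightarrow> prime p" "\<And>p. p \<in> P \<Longrightarrow> exp 1 \<le> real p" "a > 0"
  shows "real (card {p\<in>P. p dvd a}) \<le> ln a"
proof -
  let ?D = "{p\<in>P. p dvd a}" and ?F = "prime_factors a"
  have D: "?D \<subseteq> ?F" using assms by (auto simp: prime_factors_dvd)
  have "exp 1 ^ card ?D = (\<Prod>p\<in>?D. exp 1 :: real)" by simp
  also have "\<dots> \<le> (\<Prod>p\<in>?D. real p)"
    using assms by (intro prod_mono) auto
  also have "\<dots> \<le> (\<Prod>p\<in>?F. real p)"
    using D by (intro prod_mono2) (auto simp: in_prime_factors_iff prime_ge_1_nat)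
  also have "\<dots> \<le> (\<Prod>p\<in>?F. real p ^ multiplicity p a)"
    by (intro prod_mono conjI self_le_power)
       (auto simp: in_prime_factors_iff prime_ge_1_nat intro: prime_multiplicity_gt_zero_iff[THEN iffD2])
  also have "\<dots> = real a"
    using prime_factorization_nat[OF assms(4)] by (metis (no_types, lifting) of_nat_prod of_nat_power prod.cong)
  finally have "exp (real (card ?D)) \<le> real a" by (simp flip: exp_of_nat_mult)
  thus ?thesis using assms(4) by (simp add: ln_ge_iff)
qed

lemma abs_cos_le_exp: "\<bar>cos x\<bar> \<le> exp (- (sin x)\<^sup>2 / 2)" for x :: real
proof -
  have "(cos x)\<^sup>2 = 1 - (sin x)\<^sup>2" by (simp add: cos_squared_eq)
  also have "\<dots> \<le> exp (- (sin x)\<^sup>2)" using exp_ge_add_one_self[of "- (sin x)\<^sup>2"] by simp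
  also have "\<dots> = (exp (- (sin x)\<^sup>2 / 2))\<^sup>2" by (simp add: power2_eq_square flip: exp_add)
  finally show ?thesis using abs_le_square_iff[of "cos x" "exp (- (sin x)\<^sup>2 / 2)"] by simp
qed


lemma cos_ge_one_minus_half_square: "1 - x\<^sup>2 / 2 \<le> cos x" for x :: real
proof -
  have "(sin (x / 2))\<^sup>2 \<le> (x / 2)\<^sup>2"
    using abs_sin_x_le_abs_x[of "x / 2"] by (simp only: abs_le_square_iff)
  thus ?thesis using cos_double_sin[of "x / 2"] by (simp add: power2_eq_square)
qed

lemma card_nat_near_le:
  fixes c r :: real
  assumes "r \<ge> 0"
  shows "finite {a::nat. \<bar>c - a\<bar> \<le> r}" "real (card {a::nat. \<bar>c - a\<bar> \<le> r}) \<le> 2 * r + 1"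
proof -
  let ?J = "{a::nat. \<bar>c - a\<bar> \<le> r}" and ?I = "{\<lceil>c - r\<rceil>..\<lfloor>c + r\<rfloor>}"
  have sub: "int ` ?J \<subseteq> ?I" by (auto simp: ceiling_le_iff le_floor_iff)
  have fin: "finite (int ` ?J)" by (rule finite_subset[OF sub]) auto
  thus "finite ?J" by (rule finite_imageD) auto
  have "card ?J = card (int ` ?J)" by (rule card_image[symmetric]) auto
  also have "\<dots> \<le> card ?I" by (rule card_mono[OF _ sub]) auto
  finally have "real (card ?J) \<le> real (card ?I)" by simp
  also have "\<dots> \<le> 2 * r + 1"
  proof (cases "\<lceil>c - r\<rceil> \<le> \<lfloor>c + r\<rfloor>")
    case True
    hence "real (card ?I) = of_int (\<lfloor>c + r\<rfloor> - \<lceil>c - r\<rceil> + 1)" by simp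
    thus ?thesis using of_int_floor_le[of "c + r"] le_of_int_ceiling[of "c - r"] unfolding of_int_add of_int_diff by linarith
  qed (use assms in auto)
  finally show "real (card ?J) \<le> 2 * r + 1" .
qed

text \<open>Call \<open>p\<close> bad if \<open>\<bar>sin (x / p)\<bar> < \<eta>\<close>. Every bad
  prime divides one of at most \<open>2 * \<eta> * R + 1\<close> integers near
  \<open>x / pi\<close>, each with at most \<open>L\<close> divisors in \<open>P\<close>. By
  \<open>card\<close> at least half of \<open>P\<close> is then good, and each good prime
  contributes a factor of at most \<open>exp (- \<eta>\<^sup>2 / 2)\<close>.\<close>

lemma abs_prod_cos_le:
  fixes P :: "nat set" and x R L \<eta> :: real
  assumes P: "finite P" "\<And>p. p \<in> P \<Longrightarrow> prime p" "\<And>p. p \<in> P \<Longrightarrow> exp 1 \<le> real p"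
      "\<And>p. p \<in> P \<Longrightarrow> real p \<le> R"
    and \<eta>: "\<eta> > 0" and R: "R \<ge> 0" and x: "x > 0" "4 * \<eta> * R \<le> x" "ln x \<le> L" and L0: "L \<ge> 0"
    and card: "(2 * \<eta> * R + 1) * L \<le> real (card P) / 2"
  shows "\<bar>\<Prod>p\<in>P. cos (x / real p)\<bar> \<le> exp (- real (card P) * \<eta>\<^sup>2 / 4)"
proof -
  let ?B = "{p\<in>P. \<bar>sin (x / p)\<bar> < \<eta>}" and ?J = "{a::nat. \<bar>x / pi - a\<bar> \<le> \<eta> * R}"
  have \<eta>R: "\<eta> * R \<ge> 0" using \<eta> R by simp
  have xpi: "x / pi > \<eta> * R" "x / pi \<le> x / 3"
  proof -
    have "x / pi > x / 4" using x pi_less_4 by (intro divide_strict_left_mono) auto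
    thus "x / pi > \<eta> * R" using x by linarith
    show "x / pi \<le> x / 3" using x pi_gt3 by (intro divide_left_mono) auto
  qed
  have J: "finite ?J" "real (card ?J) \<le> 2 * (\<eta> * R) + 1"
    using card_nat_near_le[OF \<eta>R] by auto
  \<comment> \<open>If \<open>x / p\<close> is near \<open>m \<pi>\<close>, then \<open>p\<close> divides the integer \<open>m p\<close>, which is near \<open>x / \<pi>\<close>.\<close>
  have B: "?B \<subseteq> (\<Union>a\<in>?J. {p\<in>P. p dvd a})"
  proof
    fix p assume p: "p \<in> ?B"
    hence p0: "real p > 0" using P(2)[of p] prime_gt_0_nat by auto
    obtain m :: int where m: "\<bar>x / p - pi * m\<bar> \<le> 2 * \<bar>sin (x / p)\<bar>"
      using near_multiple_of_pi by blast
    hence "\<bar>x / p - pi * m\<bar> * (p / pi) \<le> 2 * \<eta> * (p / pi)"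
      using p p0 by (intro mult_right_mono) auto
    also have "\<bar>x / p - pi * m\<bar> * (p / pi) = \<bar>(x / p - pi * m) * (p / pi)\<bar>"
      using p0 by (simp add: abs_mult)
    also have "(x / p - pi * m) * (p / pi) = x / pi - real_of_int m * real p"
      using p0 by (simp add: field_simps)
    also have "2 * \<eta> * (p / pi) = \<eta> * p * (2 / pi)" by simp
    also have "\<dots> \<le> \<eta> * p * 1" using \<eta> p0 pi_gt3 by (intro mult_left_mono) auto
    also have "\<dots> \<le> \<eta> * R" using \<eta> P(4)[of p] p by auto
    finally have *: "\<bar>x / pi - real_of_int m * real p\<bar> \<le> \<eta> * R" .
    \<comment> \<open>Since \<open>x / pi\<close> exceeds \<open>\<eta> * R\<close>, the nearby
      multiple of \<open>p\<close> is positive, hence a natural number to which the count of prime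
      divisors applies.\<close>
    have "0 < real_of_int m * real p" using * xpi by linarith
    hence "m > 0" using p0 by (simp add: zero_less_mult_iff)
    hence mp: "real_of_int m * real p = real (nat m * p)" by simp
    have "nat m * p \<in> ?J" using *[unfolded mp] by (rule CollectI)
    thus "p \<in> (\<Union>a\<in>?J. {p\<in>P. p dvd a})" using p by (intro UN_I[of "nat m * p"]) auto
  qed
  have L: "real (card {p\<in>P. p dvd a}) \<le> L" if a: "a \<in> ?J" for a
  proof -
    \<comment> \<open>Here \<open>a\<close> is below \<open>2 * (x / pi)\<close>, which is at most
      \<open>2 * x / 3\<close>.\<close>
    have "real a > 0" "real a \<le> x" using a xpi x unfolding mem_Collect_eq by linarith+
    hence "ln (real a) \<le> ln x" by simp
    moreover have "real (card {p\<in>P. p dvd a}) \<le> ln (real a)"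
      using \<open>real a > 0\<close> by (intro card_prime_divisors_le P) auto
    ultimately show ?thesis using x(3) by linarith
  qed
  have "card ?B \<le> card (\<Union>a\<in>?J. {p\<in>P. p dvd a})"
    by (rule card_mono[OF _ B]) (use J P in auto)
  also have "\<dots> \<le> (\<Sum>a\<in>?J. card {p\<in>P. p dvd a})" by (rule card_UN_le[OF J(1)])
  finally have "real (card ?B) \<le> real (\<Sum>a\<in>?J. card {p\<in>P. p dvd a})" by (rule of_nat_mono)
  also have "\<dots> = (\<Sum>a\<in>?J. real (card {p\<in>P. p dvd a}))" by (rule of_nat_sum)
  also have "\<dots> \<le> card ?J * L" using L by (rule sum_bounded_above)
  also have "\<dots> \<le> (2 * \<eta> * R + 1) * L"
    using J L0 by (intro mult_right_mono) auto
  also note card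
  finally have B2: "real (card ?B) \<le> real (card P) / 2" .
  have "card (P - ?B) = card P - card ?B" by (rule card_Diff_subset) (use P in auto)
  moreover have "card ?B \<le> card P" by (rule card_mono) (use P in auto)
  ultimately have good: "real (card (P - ?B)) \<ge> real (card P) / 2" using B2 by simp
  have "real (card P) / 2 * \<eta>\<^sup>2 \<le> real (card (P - ?B)) * \<eta>\<^sup>2"
    using good by (intro mult_right_mono) auto
  also have "\<dots> = (\<Sum>p\<in>P-?B. \<eta>\<^sup>2)" by simp
  also have "\<dots> \<le> (\<Sum>p\<in>P-?B. (sin (x / p))\<^sup>2)"
    using \<eta> by (intro sum_mono) (auto simp flip: abs_le_square_iff)
  also have "\<dots> \<le> (\<Sum>p\<in>P. (sin (x / p))\<^sup>2)"
    using P by (intro sum_mono2) auto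
  finally have S: "real (card P) / 2 * \<eta>\<^sup>2 \<le> (\<Sum>p\<in>P. (sin (x / p))\<^sup>2)" .
  have "\<bar>\<Prod>p\<in>P. cos (x / real p)\<bar> \<le> (\<Prod>p\<in>P. exp (- (sin (x / p))\<^sup>2 / 2))"
    unfolding abs_prod by (intro prod_mono conjI abs_cos_le_exp abs_ge_zero)
  also have "\<dots> = exp (- (\<Sum>p\<in>P. (sin (x / p))\<^sup>2) / 2)"
    using P by (simp add: exp_sum[symmetric] sum_negf sum_divide_distrib)
  also have "\<dots> \<le> exp (- real (card P) * \<eta>\<^sup>2 / 4)" using S by simp
  finally show ?thesis .
qed

text \<open>If every signed sum stayed at distance \<open>exp (- L / 3)\<close> from
  \<open>t\<close>, the Fejer integral over \<open>{0..T}\<close> would be below 1/16. But it gains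
  at least 1/8 on \<open>{0..1}\<close> and loses at most 1/16 on \<open>{1..T}\<close>.\<close>

lemma signed_prime_reciprocals_near:
  fixes P :: "nat set" and y R L \<eta> t :: real
  assumes P: "finite P" "\<And>p. p \<in> P \<Longrightarrow> prime p" "\<And>p. p \<in> P \<Longrightarrow> y < real p"
      "\<And>p. p \<in> P \<Longrightarrow> real p \<le> R"
    and y: "exp 1 \<le> y" "real (card P) \<le> y\<^sup>2"
    and \<eta>: "\<eta> > 0" "1 \<le> 4 * \<eta> * R" "4 * \<eta> * R \<le> y"
    and card: "(2 * \<eta> * R + 1) * L \<le> real (card P) / 2"
    and L: "L \<ge> 96" "L + 15 \<le> real (card P) * \<eta>\<^sup>2 / 4"
    and t: "\<bar>t\<bar> \<le> 1 / (4 * \<eta> * R)"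
  shows "\<exists>s. (\<forall>p\<in>P. s p \<in> {-1, 1 :: real}) \<and> \<bar>(\<Sum>p\<in>P. s p / p) - t\<bar> < exp (- L / 3)"
proof (rule ccontr)
  assume contr: "\<not> ?thesis"
  \<comment> \<open>With distance \<open>d = exp (- L / 3)\<close>, the quantity
    \<open>T * d\<^sup>2\<close> in the Fejer bound is still \<open>exp (L / 3)\<close>.\<close>
  define T where "T = exp L"
  define \<phi> where "\<phi> x = (\<Prod>p\<in>P. cos (x * (1 / real p)))" for x
  define h where "h x = (1 - x / T) * (\<phi> x * cos (x * t))" for x
  have T: "T \<ge> 2" using exp_ge_add_one_self[of L] L(1) unfolding T_def by linarith
  have T32: "exp (L / 3) > 32"
    using exp_ge_add_one_self[of "L / 3"] L(1) by linarith
  have "integral {0..T} h \<le> 2 / (T * (exp (- L / 3))\<^sup>2)"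
    unfolding h_def \<phi>_def
  proof (intro integral_prod_cos_le integral_fejer_cos_le P(1))
    fix s assume "\<forall>p\<in>P. s p \<in> {-1, 1 :: real}"
    thus "exp (- L / 3) \<le> \<bar>(\<Sum>p\<in>P. s p * (1 / real p)) - t\<bar>"
      using contr by (auto simp: not_less)
  qed (use T in auto)
  also have "T * (exp (- L / 3))\<^sup>2 = exp (L / 3)"
    unfolding T_def power2_eq_square exp_add[symmetric] by simp
  also have "2 / exp (L / 3) < 1 / 16" using T32 by (simp add: field_simps)
  finally have upper: "integral {0..T} h < 1 / 16" .
  have cont: "continuous_on A h" for A
    unfolding h_def \<phi>_def divide_inverse by (intro continuous_intros)
  have int: "h integrable_on {a..b}" for a b
    by (intro integrable_continuous_real cont)
  have R: "R > 0"
  proof (rule ccontr)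
    assume "\<not> R > 0"
    hence "\<eta> * R \<le> 0" using \<eta>(1) by (intro mult_nonneg_nonpos) auto
    thus False using \<eta>(2) by linarith
  qed
  \<comment> \<open>In this range \<open>x \<le> y < p\<close>, so all angles \<open>x / p\<close>
    are at most 1, and the bound on \<open>t\<close> gives
    \<open>\<bar>x * t\<bar> \<le> 1 < pi / 3\<close>.\<close>
  have pos: "\<phi> x > 0" "cos (x * t) \<ge> 1 / 2" if x: "0 \<le> x" "x \<le> 4 * \<eta> * R" for x
  proof -
    have "0 < cos (x * (1 / real p))" if p: "p \<in> P" for p
    proof (rule cos_gt_zero_pi)
      have "x * (1 / real p) \<le> 1" "0 \<le> x * (1 / real p)"
        using x \<eta> P(3)[OF p] by (auto simp: field_simps)
      thus "- (pi / 2) < x * (1 / real p)" "x * (1 / real p) < pi / 2"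
        using pi_gt3 by linarith+
    qed
    thus "\<phi> x > 0" unfolding \<phi>_def by (rule prod_pos)
    have "\<bar>x * t\<bar> \<le> (4 * \<eta> * R) * (1 / (4 * \<eta> * R))"
      unfolding abs_mult using x t \<eta> R by (intro mult_mono) auto
    also have "\<dots> = 1" using \<eta> R by simp
    finally have "\<bar>x * t\<bar> \<le> pi / 3" using pi_gt3 by linarith
    hence "cos (pi / 3) \<le> cos \<bar>x * t\<bar>" by (subst cos_mono_le_eq) auto
    thus "cos (x * t) \<ge> 1 / 2" by (simp add: cos_60)
  qed
  \<comment> \<open>Each of the three factors of \<open>h x\<close> is at least 1/2. For the cosine
    product this is the Weierstrass inequality, as the sum of \<open>1 / (2 * p\<^sup>2)\<close>
    over \<open>P\<close> is at most \<open>card P / (2 * y\<^sup>2)\<close>.\<close>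
  have low: "h x \<ge> 1 / 8" if x: "x \<in> {0..1}" for x
  proof -
    have y0: "y > 0" using y(1) exp_gt_zero[of "1::real"] by linarith
    have p1: "1 / (2 * (real p)\<^sup>2) \<in> {0..1}" if "p \<in> P" for p
    proof -
      have "(real p)\<^sup>2 \<ge> 1" using P(2)[OF that] prime_ge_1_nat[of p] by simp
      hence "1 / (2 * (real p)\<^sup>2) \<le> 1 / 1" by (intro frac_le) auto
      thus ?thesis by simp
    qed
    have "1 / 2 \<le> 1 - (\<Sum>p\<in>P. 1 / 2 / y\<^sup>2)"
      using y(2) y0 by (simp add: field_simps)
    also have "\<dots> \<le> 1 - (\<Sum>p\<in>P. 1 / (2 * (real p)\<^sup>2))"
    proof (intro diff_left_mono sum_mono)
      fix p assume "p \<in> P"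
      hence "y\<^sup>2 \<le> (real p)\<^sup>2" using P(3)[of p] y0 by (intro power_mono) auto
      thus "1 / (2 * (real p)\<^sup>2) \<le> 1 / 2 / y\<^sup>2" using y0 by (simp add: frac_le)
    qed
    also have "\<dots> \<le> (\<Prod>p\<in>P. 1 - 1 / (2 * (real p)\<^sup>2))"
      by (rule Weierstrass_prod_ineq) (rule p1)
    also have "\<dots> \<le> \<phi> x" unfolding \<phi>_def
    proof (intro prod_mono conjI)
      fix p assume p: "p \<in> P"
      show "0 \<le> 1 - 1 / (2 * (real p)\<^sup>2)" using p1[OF p] by simp
      have "(x * (1 / real p))\<^sup>2 \<le> (1 / real p)\<^sup>2"
        using x by (intro power_mono) (auto simp: divide_right_mono)
      thus "1 - 1 / (2 * (real p)\<^sup>2) \<le> cos (x * (1 / real p))"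
        using cos_ge_one_minus_half_square[of "x * (1 / real p)"] by (simp add: power_divide)
    qed
    finally have \<phi>: "1 / 2 \<le> \<phi> x" .
    have "1 / 2 * (1 / 2 * (1 / 2)) \<le> h x"
      unfolding h_def using x T \<phi> pos[of x] \<eta> by (intro mult_mono) (auto simp: field_simps)
    thus ?thesis by simp
  qed
  \<comment> \<open>Up to \<open>4 * \<eta> * R\<close> positivity suffices; beyond it
    \<open>abs_prod_cos_le\<close> applies. The summand 15 in the hypothesis on \<open>L\<close>
    supplies the factor 1/16, because \<open>exp 15 \<ge> 16\<close>.\<close>
  have low': "h x \<ge> - (1 / (16 * T))" if x: "x \<in> {1..T}" for x
  proof (cases "x \<le> 4 * \<eta> * R")
    case True
    have "0 \<le> h x" unfolding h_def
      using pos[of x] True x T by (intro mult_nonneg_nonneg) auto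
    thus ?thesis using T by (smt (verit) divide_nonneg_pos)
  next
    case False
    have "\<bar>\<phi> x\<bar> \<le> exp (- real (card P) * \<eta>\<^sup>2 / 4)"
      unfolding \<phi>_def 
    proof (simp only: times_divide_eq_right mult_1_right, rule abs_prod_cos_le[OF P(1,2) _ P(4) \<eta>(1)])
      show "ln x \<le> L" using x ln_le_cancel_iff[of x T] by (simp add: T_def)
      show "exp 1 \<le> real p" if "p \<in> P" for p using P(3)[OF that] y by linarith
    qed (use False R L card x in auto)
    also have "\<dots> \<le> exp (- (L + 15))" using L by simp
    also have "\<dots> = exp (- 15) / T" by (simp add: T_def exp_diff exp_minus field_simps exp_add)
    also have "\<dots> \<le> (1 / 16) / T"
      using exp_ge_add_one_self[of 15] T by (intro divide_right_mono) (auto simp: exp_minus field_simps)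
    finally have \<phi>: "\<bar>\<phi> x\<bar> \<le> 1 / (16 * T)" by simp
    have "\<bar>h x\<bar> = \<bar>1 - x / T\<bar> * (\<bar>\<phi> x\<bar> * \<bar>cos (x * t)\<bar>)" by (simp add: h_def abs_mult)
    also have "\<dots> \<le> 1 * (1 / (16 * T) * 1)"
      using x T \<phi> by (intro mult_mono) auto
    finally show ?thesis by simp
  qed
  have "integral {0..1} (\<lambda>_::real. 1 / 8) \<le> integral {0..1} h"
    by (intro integral_le int low) auto
  hence "1 / 8 \<le> integral {0..1} h" by simp
  moreover have "- (1 / 16) \<le> integral {1..T} h"
  proof -
    have "- (1 / 16) \<le> (T - 1) * (- (1 / (16 * T)))" using T by (simp add: field_simps)
    also have "\<dots> = integral {1..T} (\<lambda>_::real. - (1 / (16 * T)))" using T by simp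
    also have "\<dots> \<le> integral {1..T} h"
      by (intro integral_le int low') auto
    finally show ?thesis .
  qed
  moreover have "integral {0..T} h = integral {0..1} h + integral {1..T} h"
    using T by (intro Henstock_Kurzweil_Integration.integral_combine[symmetric] int) auto
  ultimately show False using upper by linarith
qed

section \<open>Lower bounds for primes\<close>

text \<open>A real bound avoids rounding thresholds such as \<open>R powr (3/4)\<close>.\<close>

definition primes_le :: "real \<Rightarrow> nat set" where
  "primes_le x = {p. prime p \<and> real p \<le> x}"

lemma finite_primes_le [simp]: "finite (primes_le x)"
  by (rule finite_subset[of _ "{..nat \<lfloor>x\<rfloor>}"]) (auto simp: primes_le_def le_nat_floor)

lemma primes_le_mono: "x \<le> y \<Longrightarrow> primes_le x \<subseteq> primes_le y"
  by (auto simp: primes_le_def)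

section \<open>Chebyshev's lower bound from the central binomial coefficient\<close>

text \<open>Legendre's formula. From \<open>n\<close> to \<open>Suc n\<close> the quotient by
  \<open>p ^ i\<close> grows by one exactly when \<open>p ^ i\<close> divides \<open>Suc n\<close>,
  that is, for \<open>i\<close> up to the multiplicity of \<open>p\<close> in \<open>Suc n\<close>;
  the bound on \<open>n\<close> keeps that multiplicity within \<open>r\<close>.\<close>

lemma multiplicity_fact:
  fixes p :: nat
  assumes p: "prime p" and "n < p ^ Suc r"
  shows "multiplicity p (fact n :: nat) = (\<Sum>i=1..r. n div p ^ i)"
  using assms(2)
proof (induction n)
  case 0
  thus ?case by simp
next
  case (Suc n)
  have le: "multiplicity p (Suc n) \<le> r"
  proof (rule ccontr)
    assume "\<not> ?thesis"
    hence "p ^ Suc r dvd Suc n" by (intro multiplicity_dvd') auto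
    thus False using Suc.prems by (auto dest: dvd_imp_le)
  qed
  have "(\<Sum>i=1..r. Suc n div p ^ i) =
      (\<Sum>i=1..r. n div p ^ i + (if p ^ i dvd Suc n then 1 else 0))"
    by (intro sum.cong refl) (simp add: div_Suc dvd_eq_mod_eq_0)
  also have "\<dots> = (\<Sum>i=1..r. n div p ^ i) + card {i\<in>{1..r}. p ^ i dvd Suc n}"
    by (simp only: sum.distrib) (simp flip: sum.inter_filter)
  also have "{i\<in>{1..r}. p ^ i dvd Suc n} = {1..multiplicity p (Suc n)}"
  proof -
    have "p ^ i dvd Suc n \<longleftrightarrow> i \<le> multiplicity p (Suc n)" for i
      by (rule power_dvd_iff_le_multiplicity) (use prime_gt_1_nat[OF p] in simp_all)
    hence "i \<in> {i\<in>{1..r}. p ^ i dvd Suc n} \<longleftrightarrow> i \<in> {1..multiplicity p (Suc n)}" for i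
      using le by (simp only: mem_Collect_eq atLeastAtMost_iff) linarith
    thus ?thesis by blast
  qed
  also have "(\<Sum>i=1..r. n div p ^ i) = multiplicity p (fact n :: nat)"
    using Suc by simp
  also have "\<dots> + card {1..multiplicity p (Suc n)} = multiplicity p (fact (Suc n) :: nat)"
    using p by (simp add: prime_elem_multiplicity_mult_distrib del: mult_Suc)
  finally show ?case ..
qed

text \<open>In Legendre's formula each \<open>i\<close> contributes
  \<open>2 * n div p ^ i - 2 * (n div p ^ i)\<close>, which is 0 or 1, and only the \<open>r\<close>
  powers of \<open>p\<close> up to \<open>2 * n\<close> count.\<close>

lemma prime_power_central_binomial_le:
  fixes p n :: nat
  assumes p: "prime p" and n: "n > 0"
  shows "p ^ multiplicity p ((2 * n) choose n) \<le> 2 * n"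
proof -
  obtain r where r: "p ^ r \<le> 2 * n" "2 * n < p ^ Suc r"
    using ex_power_ivl1[of p "2 * n"] prime_ge_2_nat[OF p] n by auto
  have "fact n * fact n * ((2 * n) choose n) = (fact (2 * n) :: nat)"
    using binomial_fact_lemma[of n "2 * n"] by simp
  hence "multiplicity p (fact (2 * n) :: nat) =
      2 * multiplicity p (fact n :: nat) + multiplicity p ((2 * n) choose n)"
    using p by (simp add: prime_elem_multiplicity_mult_distrib flip: \<open>_ = fact (2 * n)\<close>)
  hence "(\<Sum>i=1..r. (2 * n) div p ^ i) =
      2 * (\<Sum>i=1..r. n div p ^ i) + multiplicity p ((2 * n) choose n)"
    using multiplicity_fact[OF p r(2)] multiplicity_fact[OF p, of n r] r(2) by simp
  moreover have "(\<Sum>i=1..r. (2 * n) div p ^ i) \<le> (\<Sum>i=1..r. 2 * (n div p ^ i) + 1)"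
  proof (intro sum_mono)
    fix i
    have d: "p ^ i > 0" using p prime_gt_0_nat by auto
    have "n < (n div p ^ i + 1) * p ^ i"
      using d dividend_less_div_times[of "p ^ i" n] by simp
    hence "2 * n < (2 * (n div p ^ i) + 2) * p ^ i" by simp
    hence "2 * n div p ^ i < 2 * (n div p ^ i) + 2" using d by (simp add: div_less_iff_less_mult)
    thus "2 * n div p ^ i \<le> 2 * (n div p ^ i) + 1" by simp
  qed
  ultimately have "multiplicity p ((2 * n) choose n) \<le> r"
    by (simp only: sum.distrib sum_distrib_left[symmetric]) simp
  hence "p ^ multiplicity p ((2 * n) choose n) \<le> p ^ r"
    using p prime_ge_1_nat by (intro power_increasing) auto
  thus ?thesis using r by simp
qed

text \<open>Take logarithms in \<open>4 ^ n / (2 * n) \<le> (2 * n) choose n\<close>, whose right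
  side has at most one prime power, itself at most \<open>2 * n\<close>, for each prime up to
  \<open>2 * n\<close>.\<close>

lemma card_primes_le_even:
  assumes n: "n > 0"
  shows "real n * ln 4 - ln (2 * real n) \<le> card (primes_le (2 * real n)) * ln (2 * real n)"
proof -
  let ?C = "(2 * n) choose n" and ?\<pi> = "card (primes_le (2 * real n))"
  have C: "?C > 0" by simp
  have sub: "prime_factors ?C \<subseteq> primes_le (2 * real n)"
  proof
    fix p assume p: "p \<in> prime_factors ?C"
    hence "p ^ 1 \<le> p ^ multiplicity p ?C"
      by (intro power_increasing) (auto simp: prime_factors_multiplicity prime_gt_0_nat Suc_le_eq)
    also have "\<dots> \<le> 2 * n" using p n by (intro prime_power_central_binomial_le) auto
    finally show "p \<in> primes_le (2 * real n)" using p by (simp add: primes_le_def in_prime_factors_iff)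
  qed
  have "?C = (\<Prod>p\<in>prime_factors ?C. p ^ multiplicity p ?C)"
    using C by (intro prime_factorization_nat)
  also have "\<dots> \<le> (\<Prod>p\<in>prime_factors ?C. 2 * n)"
    using n by (intro prod_mono) (auto intro: prime_power_central_binomial_le)
  also have "\<dots> = (2 * n) ^ card (prime_factors ?C)" by (rule prod_constant)
  also have "\<dots> \<le> (2 * n) ^ ?\<pi>"
    using n by (intro power_increasing card_mono finite_primes_le sub) auto
  finally have "real ?C \<le> real ((2 * n) ^ ?\<pi>)" by (simp only: of_nat_le_iff)
  hence "4 ^ n / (2 * real n) \<le> (2 * real n) ^ ?\<pi>"
    using central_binomial_lower_bound[OF n] by simp
  hence "ln (4 ^ n / (2 * real n)) \<le> ln ((2 * real n) ^ ?\<pi>)"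
    using n by (subst ln_le_cancel_iff) auto
  also have "ln ((2 * real n) ^ ?\<pi>) = ?\<pi> * ln (2 * real n)" using n by (simp only: ln_realpow)
  finally show ?thesis using n by (simp add: ln_div ln_realpow)
qed

lemma eventually_card_primes_le_ge:
  "eventually (\<lambda>x. x / (2 * ln x) \<le> card (primes_le x)) at_top"
proof -
  \<comment> \<open>Rounding to an even integer and the term \<open>ln x\<close> are absorbed by the
    gap between 2/3, coming from \<open>ln 4 \<ge> 4 / 3\<close>, and the claimed 1/2.\<close>
  have "eventually (\<lambda>x::real. (x / 2 - 1) * (4 / 3) - ln x \<ge> x / 2) at_top" by real_asymp
  moreover have "eventually (\<lambda>x::real. x > 2) at_top" by (rule eventually_gt_at_top)
  ultimately show ?thesis
  proof eventually_elim
    case (elim x)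
    define n where "n = nat \<lfloor>x / 2\<rfloor>"
    have n: "n > 0" "real n \<le> x / 2" "x / 2 - 1 \<le> real n" using elim unfolding n_def by linarith+
    have n1: "1 \<le> 2 * real n" using n(1) by linarith
    have lnx: "ln x > 0" using elim by simp
    have "ln (4 :: real) = 2 * ln 2" using ln_realpow[of 2 2] by simp
    hence ln4: "ln (4 :: real) \<ge> 4 / 3" using ln2_ge_two_thirds by simp
    have "x / 2 \<le> (x / 2 - 1) * (4 / 3) - ln x" by (fact elim)
    also have "\<dots> \<le> real n * ln 4 - ln (2 * real n)"
      using n ln4 ln_le_cancel_iff[of "2 * real n" x] elim by (intro diff_mono mult_mono) auto
    also have "\<dots> \<le> card (primes_le (2 * real n)) * ln (2 * real n)"
      by (rule card_primes_le_even[OF n(1)])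
    also have "\<dots> \<le> card (primes_le x) * ln x"
      using n n1 ln_le_cancel_iff[of "2 * real n" x] elim lnx
      by (intro mult_mono) (auto intro!: card_mono primes_le_mono simp: ln_ge_zero_iff Suc_le_eq)
    finally show ?case using lnx by (simp add: field_simps)
  qed
qed

section \<open>Divergence of the sum of prime reciprocals\<close>

text \<open>
  Partial summation: the difference of \<open>\<Sum>1/p\<close> and \<open>\<pi>(n)/n\<close> grows by exactly \<open>\<pi>(n)/(n(n+1))\<close>
  from \<open>n\<close> to \<open>n + 1\<close>.
\<close>

lemma sum_prime_reciprocals_ge_ln_ln:
  assumes "n0 \<ge> 3" "\<And>n. n \<ge> n0 \<Longrightarrow> real n / (2 * ln (real n)) \<le> card (primes_le (real n))" "n \<ge> n0"
  shows "(ln (ln (real n)) - ln (ln (real n0))) / 4 \<le>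
    (\<Sum>p\<in>primes_le (real n). 1 / real p) - (real (card (primes_le (real n))) / real n - 1)"
  using assms(3)
proof (induction n rule: dec_induct)
  case base
  \<comment> \<open>The \<open>- 1\<close> in the statement compensates for the density at
    \<open>n0\<close>, so the right side starts out nonnegative.\<close>
  have "card (primes_le (real n0)) \<le> card {1..n0}"
    by (rule card_mono) (use prime_ge_1_nat in \<open>auto simp: primes_le_def\<close>)
  hence "real (card (primes_le (real n0))) / real n0 \<le> 1" using assms(1) by simp
  moreover have "0 \<le> (\<Sum>p\<in>primes_le (real n0). 1 / real p)" by (intro sum_nonneg) auto
  ultimately show ?case by simp
next
  case (step n)
  let ?\<pi> = "real (card (primes_le (real n)))" and ?S = "(\<Sum>p\<in>primes_le (real n). 1 / real p)"
  have n: "real n \<ge> 3" using step assms(1) by simp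
  have lnn: "ln (real n) > 0" using n by simp
  \<comment> \<open>Applying \<open>ln z \<le> z - 1\<close> twice bounds the increment of
    \<open>ln ln\<close> by \<open>1 / (n * ln n)\<close>, which the Chebyshev bound turns into four
    times the partial summation term.\<close>
  have "ln (ln (real (Suc n))) - ln (ln (real n)) = ln (ln (real (Suc n)) / ln (real n))"
    using n by (simp add: ln_div)
  also have "\<dots> \<le> ln (real (Suc n)) / ln (real n) - 1"
    using n by (intro ln_le_minus_one) auto
  also have "\<dots> = (ln (real (Suc n) / real n)) / ln (real n)"
    using n lnn by (simp add: ln_div diff_divide_distrib)
  also have "\<dots> \<le> (real (Suc n) / real n - 1) / ln (real n)"
    using n lnn by (intro divide_right_mono ln_le_minus_one) auto
  also have "\<dots> = 1 / (real n * ln (real n))" using n by (simp add: field_simps)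
  also have "\<dots> = 4 * ((real n / (2 * ln (real n))) / (real n * (2 * real n)))"
    using n lnn by (simp add: field_simps)
  also have "\<dots> \<le> 4 * (?\<pi> / (real n * (real n + 1)))"
    using n lnn assms(2)[of n] step by (intro mult_left_mono frac_le) auto
  finally have 1: "ln (ln (real (Suc n))) - ln (ln (real n)) \<le> 4 * (?\<pi> / (real n * (real n + 1)))" .
  have 2: "?\<pi> / (real n * (real n + 1)) = ?\<pi> / real n - ?\<pi> / (real n + 1)"
    using n by (simp add: field_simps)
  \<comment> \<open>If \<open>Suc n\<close> is prime, it adds \<open>1 / Suc n\<close> to both sums,
    which cancels.\<close>
  have 3: "(\<Sum>p\<in>primes_le (real (Suc n)). 1 / real p) - real (card (primes_le (real (Suc n)))) / real (Suc n)
      = ?S - ?\<pi> / (real n + 1)"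
  proof (cases "prime (Suc n)")
    case True
    hence "primes_le (real (Suc n)) = insert (Suc n) (primes_le (real n))"
      by (auto simp: primes_le_def le_Suc_eq simp del: of_nat_Suc)
    moreover have "Suc n \<notin> primes_le (real n)" by (simp add: primes_le_def)
    ultimately show ?thesis by (simp add: add_divide_distrib add.commute)
  next
    case False
    hence "primes_le (real (Suc n)) = primes_le (real n)"
      by (auto simp: primes_le_def le_Suc_eq simp del: of_nat_Suc)
    thus ?thesis by (simp add: add.commute)
  qed
  show ?case using step.IH 1 2 3 by argo
qed

lemma eventually_sum_prime_reciprocals_gt:
  fixes C :: real
  shows "eventually (\<lambda>x. C \<le> (\<Sum>p\<in>{p\<in>primes_le x. q < p}. 1 / real p)) at_top"
proof -
  have "eventually (\<lambda>n::nat. real n / (2 * ln (real n)) \<le> card (primes_le (real n))) sequentially"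
    using eventually_card_primes_le_ge filterlim_real_sequentially
    by (rule eventually_compose_filterlim)
  then obtain n1 where n1: "\<And>n. n \<ge> n1 \<Longrightarrow> real n / (2 * ln (real n)) \<le> card (primes_le (real n))"
    by (auto simp: eventually_sequentially)
  define n0 where "n0 = max n1 3"
  have growth: "eventually (\<lambda>x::real. (ln (ln (x - 1)) - a) / 4 - 1 \<ge> b) at_top" for a b :: real
    by real_asymp
  let ?A = "\<Sum>p\<in>primes_le (real q). 1 / real p"
  have "eventually (\<lambda>x::real. (ln (ln (x - 1)) - ln (ln (real n0))) / 4 - 1 \<ge> C + ?A) at_top"
    by (rule growth)
  moreover have "eventually (\<lambda>x. x \<ge> real n0 + 1) at_top" by (rule eventually_ge_at_top)
  ultimately show ?thesis
  proof eventually_elim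
    case (elim x)
    define n where "n = nat \<lfloor>x\<rfloor>"
    have n: "n \<ge> n0" "real n \<le> x" "x - 1 \<le> real n" using elim unfolding n_def by linarith+
    have x: "x - 1 \<ge> 3" using elim by (simp add: n0_def)
    have "C + ?A \<le> (ln (ln (x - 1)) - ln (ln (real n0))) / 4 - 1" by (fact elim)
    also have "\<dots> \<le> (ln (ln (real n)) - ln (ln (real n0))) / 4 - 1"
      using n x by simp
    also have "\<dots> \<le> (\<Sum>p\<in>primes_le (real n). 1 / real p)"
      using sum_prime_reciprocals_ge_ln_ln[of n0 n] n n1 n0_def
      by (smt (verit, ccfv_SIG) divide_nonneg_nonneg max.bounded_iff max.cobounded2 of_nat_0_le_iff)
    also have "\<dots> \<le> (\<Sum>p\<in>primes_le (real q) \<union> {p\<in>primes_le x. q < p}. 1 / real p)"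
      using primes_le_mono[OF n(2)] primes_le_mono[of _ "real q"]
      by (intro sum_mono2) (auto simp: primes_le_def intro: finite_subset[OF _ finite_primes_le[of x]])
    also have "\<dots> = ?A + (\<Sum>p\<in>{p\<in>primes_le x. q < p}. 1 / real p)"
      by (intro sum.union_disjoint)
         (auto simp: primes_le_def intro: finite_subset[OF _ finite_primes_le[of x]])
    finally show ?case by simp
  qed
qed

text \<open>This supplies the domination condition of the greedy choice. For large \<open>m\<close>
  the primes between \<open>m\<close> and \<open>m powr (15/14)\<close> suffice by Chebyshev's
  bound; for small \<open>m\<close> the divergence gives a sum of at least \<open>Q\<close>.\<close>

lemma eventually_sum_prime_reciprocals_between_ge:
  fixes Q :: nat
  shows "eventually (\<lambda>y. \<forall>m::nat. 1 \<le> m \<longrightarrow> real m \<le> y powr (14/15) \<longrightarrow>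
    real Q / real m \<le> (\<Sum>p\<in>{p\<in>primes_le y. m < p \<and> Q < p}. 1 / real p)) at_top"
proof -
  have "filterlim (\<lambda>m::nat. real m powr (15/14)) at_top sequentially" by real_asymp
  from eventually_compose_filterlim[OF eventually_card_primes_le_ge this]
  have "eventually (\<lambda>m::nat. real m powr (15/14) / (2 * ln (real m powr (15/14)))
      \<le> card (primes_le (real m powr (15/14)))) sequentially" .
  moreover have "eventually (\<lambda>m::nat. 1 / (2 * ln (real m powr (15/14))) - real m / real m powr (15/14)
      \<ge> real Q / real m) sequentially" by real_asymp
  ultimately have "eventually (\<lambda>m. (real m powr (15/14) / (2 * ln (real m powr (15/14)))
      \<le> card (primes_le (real m powr (15/14)))) \<and> 
      1 / (2 * ln (real m powr (15/14))) - real m / real m powr (15/14) \<ge> real Q / real m) sequentially"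
    by eventually_elim auto
  then obtain m1 where m1: "\<And>m. m \<ge> m1 \<Longrightarrow> real m powr (15/14) / (2 * ln (real m powr (15/14)))
      \<le> card (primes_le (real m powr (15/14)))"
    "\<And>m. m \<ge> m1 \<Longrightarrow> 1 / (2 * ln (real m powr (15/14))) - real m / real m powr (15/14) \<ge> real Q / real m"
    unfolding eventually_sequentially by blast
  \<comment> \<open>With \<open>m0 \<ge> Q\<close>, the condition \<open>Q < p\<close> is automatic
    in both cases.\<close>
  define m0 where "m0 = max m1 Q"
  from eventually_sum_prime_reciprocals_gt[of "real Q" m0] eventually_ge_at_top[of 0]
  show ?thesis
  proof eventually_elim
    case (elim y)
    show ?case
    proof (intro allI impI)
      fix m :: nat assume m: "1 \<le> m" "real m \<le> y powr (14/15)"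
      let ?B = "{p\<in>primes_le y. m < p \<and> Q < p}"
      show "real Q / real m \<le> (\<Sum>p\<in>?B. 1 / real p)"
      proof (cases "m \<ge> m0")
        case False
        have "real Q / real m \<le> real Q" using m by (simp add: field_simps mult_le_cancel_left1)
        also have "\<dots> \<le> (\<Sum>p\<in>{p\<in>primes_le y. m0 < p}. 1 / real p)" by (fact elim)
        also have "\<dots> \<le> (\<Sum>p\<in>?B. 1 / real p)"
          using False by (intro sum_mono2) (auto simp: m0_def)
        finally show ?thesis .
      next
        case True
        define z where "z = real m powr (15/14)"
        have z: "z > 0" "z \<le> y"
        proof -
          show "z > 0" using m by (simp add: z_def)
          have "z \<le> (y powr (14/15)) powr (15/14)" unfolding z_def using m by (intro powr_mono2) auto
          also have "\<dots> = y" using elim by (simp add: powr_powr)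
          finally show "z \<le> y" .
        qed
        let ?D = "{p\<in>primes_le z. m < p}"
        have "primes_le z \<subseteq> ?D \<union> {1..m}"
          using prime_ge_1_nat by (auto simp: primes_le_def)
        hence "card (primes_le z) \<le> card (?D \<union> {1..m})" by (intro card_mono) auto
        also have "\<dots> \<le> card ?D + m" using card_Un_le[of ?D "{1..m}"] by simp
        finally have "real (card (primes_le z)) \<le> real (card ?D) + real m" by linarith
        hence D: "z / (2 * ln z) - real m \<le> real (card ?D)"
          using m1(1)[of m] True unfolding z_def m0_def by simp
        have "real Q / real m \<le> 1 / (2 * ln z) - real m / z"
          using m1(2)[of m] True unfolding z_def m0_def by simp
        also have "\<dots> = (z / (2 * ln z) - real m) / z" using z by (simp add: field_simps)
        also have "\<dots> \<le> real (card ?D) / z" using D z by (intro divide_right_mono) auto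
        also have "\<dots> = (\<Sum>p\<in>?D. 1 / z)" by simp
        also have "\<dots> \<le> (\<Sum>p\<in>?D. 1 / real p)"
          using z by (intro sum_mono frac_le) (auto simp: primes_le_def prime_gt_0_nat)
        also have "\<dots> \<le> (\<Sum>p\<in>?B. 1 / real p)"
          using True primes_le_mono[OF z(2)] by (intro sum_mono2) (auto simp: m0_def)
        finally show ?thesis .
      qed
    qed
  qed
qed

section \<open>Fine and coarse approximation combined\<close>

text \<open>Going up through the indices, each term is subtracted from the remaining target with the
  target's sign. Without overshoot the bound by the remaining sum persists; an overshoot is at most
  the term itself, which the later terms and \<open>D\<close> dominate.\<close>

lemma signed_sum_greedy:
  fixes v :: "nat \<Rightarrow> real"
  assumes "finite S" "\<bar>\<tau>\<bar> \<le> (\<Sum>l\<in>S. v l) + D"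
    and "\<And>i. i \<in> S \<Longrightarrow> 0 \<le> v i"
    and "\<And>i. i \<in> S \<Longrightarrow> v i \<le> D + (\<Sum>l\<in>{l\<in>S. i < l}. v l)"
  shows "\<exists>s. (\<forall>i\<in>S. s i \<in> {-1, 1 :: real}) \<and> \<bar>(\<Sum>i\<in>S. s i * v i) - \<tau>\<bar> \<le> D"
  using assms
proof (induction S arbitrary: \<tau> rule: finite_linorder_min_induct)
  case empty
  thus ?case by simp
next
  case (insert b A)
  have b: "b \<notin> A" using insert.hyps by auto
  define e where "e = (if \<tau> \<ge> 0 then 1 else -1 :: real)"
  have eqb: "{l \<in> insert b A. b < l} = A" using insert.hyps by auto
  have vb: "v b \<le> D + (\<Sum>l\<in>A. v l)" using insert.prems(3)[of b, unfolded eqb] by simp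
  have "\<exists>s. (\<forall>i\<in>A. s i \<in> {-1, 1 :: real}) \<and> \<bar>(\<Sum>i\<in>A. s i * v i) - (\<tau> - e * v b)\<bar> \<le> D"
  proof (rule insert.IH)
    show "\<bar>\<tau> - e * v b\<bar> \<le> (\<Sum>l\<in>A. v l) + D"
      using insert.prems(1) insert.prems(2)[of b] vb b insert.hyps by (auto simp: e_def)
  next
    fix i assume i: "i \<in> A"
    have "{l \<in> insert b A. i < l} = {l \<in> A. i < l}" using insert.hyps i by fastforce
    thus "v i \<le> D + (\<Sum>l\<in>{l\<in>A. i < l}. v l)" using insert.prems(3)[of i] i by simp
  qed (use insert.prems in auto)
  then obtain s where s: "\<forall>i\<in>A. s i \<in> {-1, 1 :: real}"
    "\<bar>(\<Sum>i\<in>A. s i * v i) - (\<tau> - e * v b)\<bar> \<le> D" by blast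
  have "(\<Sum>i\<in>A. (s(b := e)) i * v i) = (\<Sum>i\<in>A. s i * v i)"
    using b by (intro sum.cong) auto
  hence "(\<Sum>i\<in>insert b A. (s(b := e)) i * v i) = e * v b + (\<Sum>i\<in>A. s i * v i)"
    using b insert.hyps by simp
  hence "\<bar>(\<Sum>i\<in>insert b A. (s(b := e)) i * v i) - \<tau>\<bar> \<le> D"
    using s(2) by (simp add: algebra_simps)
  moreover have "\<forall>i\<in>insert b A. (s(b := e)) i \<in> {-1, 1}" using s(1) by (auto simp: e_def)
  ultimately show ?case by blast
qed

text \<open>The parameters are \<open>y = R powr (3/4)\<close>,
  \<open>\<eta> = R powr (\<delta> - 1/3) / 16\<close> and
  \<open>L = R powr (1/3 - 2 * \<delta>)\<close>. As \<open>card P\<close> is at least of order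
  \<open>R / ln R\<close>, the powers \<open>R powr \<delta>\<close> to spare in
  \<open>(2 * \<eta> * R + 1) * L\<close> and \<open>card P * \<eta>\<^sup>2\<close> absorb the
  logarithm.\<close>

lemma eventually_signed_prime_reciprocals_near:
  fixes \<delta> :: real
  assumes "0 < \<delta>" "\<delta> \<le> 1 / 48"
  shows "eventually (\<lambda>R. \<forall>t. \<bar>t\<bar> \<le> 4 / R powr (2/3 + \<delta>) \<longrightarrow>
    (\<exists>s. (\<forall>p\<in>{p\<in>primes_le R. R powr (3/4) < p}. s p \<in> {-1, 1 :: real}) \<and>
       \<bar>(\<Sum>p\<in>{p\<in>primes_le R. R powr (3/4) < p}. s p / p) - t\<bar> < exp (- (R powr (1/3 - 2 * \<delta>)) / 3))) at_top"
proof -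
  have "eventually (\<lambda>R::real. exp 1 \<le> R powr (3/4)) at_top"
   "eventually (\<lambda>R::real. R \<le> (R powr (3/4))\<^sup>2) at_top"
   "eventually (\<lambda>R::real. 1 \<le> R powr (2/3 + \<delta>) / 4) at_top"
   "eventually (\<lambda>R::real. R powr (2/3 + \<delta>) / 4 \<le> R powr (3/4)) at_top"
   "eventually (\<lambda>R::real. (R powr (2/3 + \<delta>) / 8 + 1) * R powr (1/3 - 2 * \<delta>) \<le>
       (R / (2 * ln R) - R powr (3/4)) / 2) at_top"
   "eventually (\<lambda>R::real. 96 \<le> R powr (1/3 - 2 * \<delta>)) at_top"
   "eventually (\<lambda>R::real. R powr (1/3 - 2 * \<delta>) + 15 \<le>
       (R / (2 * ln R) - R powr (3/4)) * (R powr (\<delta> - 1/3) / 16)\<^sup>2 / 4) at_top"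
    using assms by real_asymp+
  with eventually_card_primes_le_ge eventually_gt_at_top[of 0] show ?thesis
  proof eventually_elim
    case (elim R)
    define P where "P = {p\<in>primes_le R. R powr (3/4) < p}"
    have mult: "4 * (R powr (\<delta> - 1/3) / 16) * R = R powr (2/3 + \<delta>) / 4"
    proof -
      have "R powr (\<delta> - 1/3) * R powr 1 = R powr (2/3 + \<delta>)"
        by (simp only: powr_add[symmetric]) (simp add: algebra_simps)
      thus ?thesis using elim by simp
    qed
    have P_le: "real (card P) \<le> R"
    proof -
      have "card P \<le> card {1..nat \<lfloor>R\<rfloor>}"
        using prime_ge_1_nat by (intro card_mono) (auto simp: P_def primes_le_def le_nat_floor)
      thus ?thesis using elim by simp linarith
    qed
    have P_ge: "R / (2 * ln R) - R powr (3/4) \<le> real (card P)"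
    proof -
      have "primes_le R \<subseteq> P \<union> {1..nat \<lfloor>R powr (3/4)\<rfloor>}"
      proof
        fix p assume "p \<in> primes_le R"
        thus "p \<in> P \<union> {1..nat \<lfloor>R powr (3/4)\<rfloor>}"
          using prime_ge_1_nat[of p] le_nat_floor[of p "R powr (3/4)"]
          by (cases "R powr (3/4) < real p") (auto simp: P_def primes_le_def)
      qed
      hence "card (primes_le R) \<le> card (P \<union> {1..nat \<lfloor>R powr (3/4)\<rfloor>})"
        by (intro card_mono) (auto simp: P_def)
      also have "\<dots> \<le> card P + nat \<lfloor>R powr (3/4)\<rfloor>"
        using card_Un_le[of P "{1..nat \<lfloor>R powr (3/4)\<rfloor>}"] by simp
      finally have "real (card (primes_le R)) \<le> real (card P) + real (nat \<lfloor>R powr (3/4)\<rfloor>)" by linarith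
      also have "real (nat \<lfloor>R powr (3/4)\<rfloor>) \<le> R powr (3/4)" by simp
      finally show ?thesis using elim by linarith
    qed
    show ?case unfolding P_def[symmetric]
    proof (intro allI impI)
      fix t assume t: "\<bar>t\<bar> \<le> 4 / R powr (2/3 + \<delta>)"
      show "\<exists>s. (\<forall>p\<in>P. s p \<in> {-1, 1 :: real}) \<and>
        \<bar>(\<Sum>p\<in>P. s p / p) - t\<bar> < exp (- (R powr (1/3 - 2 * \<delta>)) / 3)"
      proof (rule signed_prime_reciprocals_near[where y = "R powr (3/4)" and R = R and
            \<eta> = "R powr (\<delta> - 1/3) / 16"])
        show "real (card P) \<le> (R powr (3 / 4))\<^sup>2" using P_le elim by linarith
        show "1 \<le> 4 * (R powr (\<delta> - 1/3) / 16) * R" unfolding mult by (fact elim)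
        show "4 * (R powr (\<delta> - 1/3) / 16) * R \<le> R powr (3/4)" unfolding mult by (fact elim)
        show "\<bar>t\<bar> \<le> 1 / (4 * (R powr (\<delta> - 1/3) / 16) * R)" unfolding mult using t by simp
        have "2 * (R powr (\<delta> - 1/3) / 16) * R = R powr (2/3 + \<delta>) / 8" using mult by simp
        thus "(2 * (R powr (\<delta> - 1/3) / 16) * R + 1) * R powr (1/3 - 2 * \<delta>) \<le> real (card P) / 2"
          using elim P_ge by simp
        have "(R / (2 * ln R) - R powr (3/4)) * (R powr (\<delta> - 1/3) / 16)\<^sup>2 / 4 \<le>
            real (card P) * (R powr (\<delta> - 1/3) / 16)\<^sup>2 / 4"
          using P_ge by (intro divide_right_mono mult_right_mono) auto
        thus "R powr (1/3 - 2 * \<delta>) + 15 \<le> real (card P) * (R powr (\<delta> - 1/3) / 16)\<^sup>2 / 4"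
          using elim by linarith
        show "finite P" by (simp add: P_def)
      qed (use elim in \<open>auto simp: P_def primes_le_def\<close>)
    qed
  qed
qed

text \<open>The multiples \<open>Q * p\<close> with \<open>p > y\<close> are reserved. Greedy signs
  on the rest of \<open>S\<close> leave an error of at most \<open>W / Q\<close>; scaled by
  \<open>Q\<close>, it is a target that \<open>fine\<close> can hit with the reserved terms.\<close>

lemma signed_reciprocals_near:
  fixes S :: "nat set" and Q :: nat and R y z W E \<tau> :: real
  assumes S: "finite S" "\<And>m. m \<in> S \<Longrightarrow> m > 0"
    and Q: "Q > 0" "real Q \<le> y" and y: "y \<le> R"
    and QS: "\<And>p. p \<in> primes_le R \<Longrightarrow> Q < p \<Longrightarrow> Q * p \<in> S"
    and \<tau>: "real Q * \<bar>\<tau>\<bar> \<le> (\<Sum>p\<in>{p\<in>primes_le y. Q < p}. 1 / real p)"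
    and between: "\<And>m::nat. 1 \<le> m \<Longrightarrow> real m \<le> z \<Longrightarrow>
      real Q / real m \<le> (\<Sum>p\<in>{p\<in>primes_le y. m < p \<and> Q < p}. 1 / real p)"
    and W: "z > 0" "real Q / z \<le> W"
    and fine: "\<And>t. \<bar>t\<bar> \<le> W \<Longrightarrow> \<exists>s. (\<forall>p\<in>{p\<in>primes_le R. y < p}. s p \<in> {-1, 1 :: real}) \<and>
      \<bar>(\<Sum>p\<in>{p\<in>primes_le R. y < p}. s p / p) - t\<bar> < E"
  shows "\<exists>s. (\<forall>m\<in>S. s m \<in> {-1, 1 :: real}) \<and> \<bar>(\<Sum>m\<in>S. s m / m) - \<tau>\<bar> < E"
proof -
  define P where "P = {p\<in>primes_le R. y < p}"
  define A where "A = (\<lambda>p. Q * p) ` P"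
  have inj: "inj_on (\<lambda>p. Q * p) X" for X using Q by (auto simp: inj_on_def)
  have AS: "A \<subseteq> S" using Q by (auto simp: A_def P_def intro!: QS)
  have W0: "W \<ge> 0" using W by (meson divide_nonneg_pos of_nat_0_le_iff order_trans)
  have coarse: "(\<Sum>p\<in>B. 1 / real p) / Q \<le> (\<Sum>l\<in>X. 1 / real l)"
    if "finite X" "\<And>p. p \<in> B \<Longrightarrow> Q * p \<in> X" for B X
  proof -
    have "(\<Sum>p\<in>B. 1 / real p) / Q = (\<Sum>l\<in>(\<lambda>p. Q * p) ` B. 1 / real l)"
      by (subst sum.reindex[OF inj]) (simp add: sum_divide_distrib mult.commute)
    also have "\<dots> \<le> (\<Sum>l\<in>X. 1 / real l)" using that by (intro sum_mono2) auto
    finally show ?thesis .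
  qed
  \<comment> \<open>The multiples with \<open>p \<le> y\<close> are not reserved, so they drive the
    greedy stage.\<close>
  have in_rest: "Q * p \<in> S - A" if "p \<in> primes_le y" "Q < p" for p
    using QS[of p] that primes_le_mono[OF y] Q by (auto simp: A_def P_def primes_le_def)
  have "\<exists>s. (\<forall>i\<in>S - A. s i \<in> {-1, 1 :: real}) \<and> \<bar>(\<Sum>i\<in>S-A. s i * (1 / real i)) - \<tau>\<bar> \<le> W / Q"
  proof (rule signed_sum_greedy)
    have "\<bar>\<tau>\<bar> \<le> (\<Sum>p\<in>{p\<in>primes_le y. Q < p}. 1 / real p) / Q"
      using \<tau> Q by (simp add: field_simps)
    also have "\<dots> \<le> (\<Sum>l\<in>S-A. 1 / real l)" using S in_rest by (intro coarse) auto
    finally show "\<bar>\<tau>\<bar> \<le> (\<Sum>l\<in>S-A. 1 / real l) + W / Q" using W0 by (simp add: add_increasing2)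
  next
    fix i assume i: "i \<in> S - A"
    have i0: "i > 0" using i S by auto
    let ?X = "{l\<in>S-A. i < l}"
    show "1 / real i \<le> W / Q + (\<Sum>l\<in>?X. 1 / real l)"
    \<comment> \<open>Terms up to \<open>z\<close> are dominated by later ones; beyond
      \<open>z\<close> a single term is already within the tolerance \<open>W / Q\<close>.\<close>
    proof (cases "real i \<le> z")
      case True
      have "1 / real i = (real Q / real i) / Q" using Q by simp
      also have "\<dots> \<le> (\<Sum>p\<in>{p\<in>primes_le y. i < p \<and> Q < p}. 1 / real p) / Q"
        using between[of i] True i0 by (intro divide_right_mono) auto
      also have "\<dots> \<le> (\<Sum>l\<in>?X. 1 / real l)"
      proof (rule coarse)
        fix p assume p: "p \<in> {p\<in>primes_le y. i < p \<and> Q < p}"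
        hence "i < p" by simp
        moreover have "p \<le> Q * p" using Q by simp
        ultimately have "i < Q * p" by linarith
        thus "Q * p \<in> ?X" using in_rest p by auto
      qed (use S in auto)
      finally show ?thesis using W0 by (simp add: add_increasing)
    next
      case False
      hence "1 / real i \<le> 1 / z" using W by (intro divide_left_mono) auto
      also have "\<dots> = (real Q / z) / Q" using Q by simp
      also have "\<dots> \<le> W / Q" using W by (intro divide_right_mono) auto
      also have "\<dots> \<le> W / Q + (\<Sum>l\<in>?X. 1 / real l)" by (simp add: sum_nonneg)
      finally show ?thesis .
    qed
  qed (use S in auto)
  then obtain s1 where s1: "\<forall>i\<in>S-A. s1 i \<in> {-1, 1 :: real}"
    "\<bar>(\<Sum>i\<in>S-A. s1 i / real i) - \<tau>\<bar> \<le> W / Q" by auto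
  define t where "t = real Q * (\<tau> - (\<Sum>i\<in>S-A. s1 i / real i))"
  have "\<bar>t\<bar> = real Q * \<bar>(\<Sum>i\<in>S-A. s1 i / real i) - \<tau>\<bar>"
    by (simp add: t_def abs_mult abs_minus_commute)
  also have "\<dots> \<le> real Q * (W / Q)" by (intro mult_left_mono s1(2)) auto
  finally have "\<bar>t\<bar> \<le> W" using Q by simp
  then obtain s2 where s2: "\<forall>p\<in>P. s2 p \<in> {-1, 1 :: real}" "\<bar>(\<Sum>p\<in>P. s2 p / p) - t\<bar> < E"
    using fine[of t] unfolding P_def by blast
  define s where "s m = (if m \<in> A then s2 (m div Q) else s1 m)" for m
  have "(\<Sum>m\<in>A. s m / m) = (\<Sum>p\<in>P. s2 p / p) / Q"
    unfolding A_def by (subst sum.reindex[OF inj])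
      (use Q in \<open>simp add: s_def A_def sum_divide_distrib mult.commute\<close>)
  moreover have "(\<Sum>m\<in>S-A. s m / m) = (\<Sum>i\<in>S-A. s1 i / real i)"
    by (intro sum.cong) (auto simp: s_def)
  moreover have "(\<Sum>m\<in>S. s m / m) = (\<Sum>m\<in>S-A. s m / m) + (\<Sum>m\<in>A. s m / m)"
    using S AS by (intro sum.subset_diff) auto
  ultimately have "(\<Sum>m\<in>S. s m / m) - \<tau> = ((\<Sum>p\<in>P. s2 p / p) - t) / Q"
    using Q by (simp add: t_def field_simps)
  hence "\<bar>(\<Sum>m\<in>S. s m / m) - \<tau>\<bar> = \<bar>(\<Sum>p\<in>P. s2 p / p) - t\<bar> / Q" by (simp add: abs_divide)
  also have "\<dots> \<le> \<bar>(\<Sum>p\<in>P. s2 p / p) - t\<bar> / 1" using Q by (intro divide_left_mono) auto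
  also have "\<dots> < E" using s2(2) by simp
  finally have "\<bar>(\<Sum>m\<in>S. s m / m) - \<tau>\<bar> < E" .
  moreover have "\<forall>m\<in>S. s m \<in> {-1, 1}" using s1(1) s2(1) Q by (auto simp: s_def A_def)
  ultimately show ?thesis by blast
qed

section \<open>Application to products of k distinct primes\<close>

lemma prime_products_pos: "m \<in> prime_products k \<Longrightarrow> m > 0"
  by (auto simp: prime_products_def prime_gt_0_nat intro!: prod_pos)

text \<open>A prime larger than the product cannot divide it, so it is a new factor.\<close>

lemma prime_products_mult:
  assumes "finite P" "\<forall>p\<in>P. prime p" "prime p" "\<Prod>P < p"
  shows "\<Prod>P * p \<in> prime_products (Suc (card P))"
proof -
  have "p \<notin> P"
  proof
    assume "p \<in> P"
    hence "p dvd \<Prod>P" using assms(1) by (intro dvd_prodI) auto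
    moreover have "\<Prod>P > 0" using assms prime_gt_0_nat by (intro prod_pos) auto
    ultimately show False using assms(4) by (auto dest: dvd_imp_le)
  qed
  thus ?thesis using assms unfolding prime_products_def
    by (intro CollectI exI[of _ "insert p P"]) (auto simp: mult.commute)
qed

lemma bseq_image:
  assumes inf: "infinite (prime_products k)"
  shows "inj_on (bseq k) {1..N}" "bseq k ` {1..N} \<subseteq> prime_products k"
    and "m \<in> prime_products k \<Longrightarrow> m < N \<Longrightarrow> m \<in> bseq k ` {1..N}"
proof -
  show "inj_on (bseq k) {1..N}"
  proof (rule inj_onI)
    fix i j assume ij: "i \<in> {1..N}" "j \<in> {1..N}" "bseq k i = bseq k j"
    hence "i - 1 = j - 1"
      using strict_mono_enumerate[OF inf] by (auto simp: bseq_def strict_mono_eq)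
    thus "i = j" using ij by auto
  qed
  show "bseq k ` {1..N} \<subseteq> prime_products k"
    using enumerate_in_set[OF inf] by (auto simp: bseq_def)
  assume m: "m \<in> prime_products k" "m < N"
  then obtain n where n: "enumerate (prime_products k) n = m" using enumerate_Ex[OF inf m(1)] by blast
  \<comment> \<open>A strictly increasing enumeration of naturals from index 0 has its
    \<open>n\<close>-th entry at least \<open>n\<close>; hence the shifted index
    \<open>Suc n\<close> is at most \<open>N\<close>.\<close>
  have "n \<le> m" using le_enumerate[OF inf, of n] n by simp
  thus "m \<in> bseq k ` {1..N}"
    using n m by (intro image_eqI[of _ _ "Suc n"]) (auto simp: bseq_def)
qed

text \<open>By injectivity signs may be attached to the values of \<open>b\<close> instead of the
  indices; \<open>restrict\<close> makes the resulting vector extensional.\<close>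

lemma min_signed_dist_less:
  assumes inj: "inj_on b {1..N}"
    and s: "\<forall>m\<in>b ` {1..N}. s m \<in> {-1, 1 :: real}" "\<bar>(\<Sum>m\<in>b ` {1..N}. s m / m) - \<tau>\<bar> < E"
  shows "min_signed_dist b N \<tau> < E"
proof -
  let ?F = "{1..N} \<rightarrow>\<^sub>E {-1, 1 :: real}" and ?s = "restrict (\<lambda>n. s (b n)) {1..N}"
  let ?g = "\<lambda>s. \<bar>(\<Sum>n=1..N. s n / real (b n)) - \<tau>\<bar>"
  have "?s \<in> ?F" using s(1) by auto
  moreover have "finite (?g ` ?F)" by (intro finite_imageI finite_PiE) auto
  ultimately have "min_signed_dist b N \<tau> \<le> ?g ?s"
    unfolding min_signed_dist_def by (intro Min_le imageI)
  also have "(\<Sum>n=1..N. ?s n / real (b n)) = (\<Sum>m\<in>b ` {1..N}. s m / m)"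
    by (subst sum.reindex[OF inj]) simp
  also note s(2)
  finally show ?thesis .
qed

theorem theorem1p2:
  fixes k :: nat and \<epsilon> :: real and f :: "nat \<Rightarrow> real"
  assumes "k \<ge> 1"
    and "\<epsilon> > 0"
    and "f \<in> o(\<lambda>N. real N powr (1 / (2 * real k + 1) - \<epsilon>))"
  shows "\<forall>\<tau>::real. \<exists>N0. \<forall>N\<ge>N0. min_signed_dist (bseq k) N \<tau> < exp (- f N)"
proof
  fix \<tau> :: real
  \<comment> \<open>Any exponent below \<open>1/3\<close> is reached, whatever \<open>k\<close> is; note \<open>1 / (2 k + 1) \<le> 1/3\<close>.\<close>
  define \<delta> where "\<delta> = min (\<epsilon> / 3) (1 / 48)"
  have \<delta>: "0 < \<delta>" "\<delta> \<le> 1 / 48" "3 * \<delta> \<le> \<epsilon>" using assms(2) by (auto simp: \<delta>_def)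
  \<comment> \<open>For \<open>k = 1\<close> the set is empty and \<open>Q = 1\<close>.\<close>
  obtain P where P: "finite P" "P \<subseteq> {p::nat. prime p}" "card P = k - 1"
    using infinite_arbitrarily_large[OF primes_infinite] by metis
  define Q where "Q = \<Prod>P"
  have Q: "Q > 0" using P prime_gt_0_nat unfolding Q_def by (intro prod_pos) auto
  have Qp: "Q * p \<in> prime_products k" if "prime p" "Q < p" for p
    using prime_products_mult[of P p] P that assms(1) by (auto simp: Q_def)
  have inf: "infinite (prime_products k)"
  proof
    assume fin: "finite (prime_products k)"
    have "{p. prime p} \<subseteq> {..Q} \<union> (\<lambda>m. m div Q) ` prime_products k"
    proof
      fix p :: nat assume "p \<in> {p. prime p}"
      thus "p \<in> {..Q} \<union> (\<lambda>m. m div Q) ` prime_products k"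
        using Qp[of p] Q image_eqI[of p "\<lambda>m. m div Q" "Q * p"] by (cases "p \<le> Q") auto
    qed
    moreover have "finite ({..Q} \<union> (\<lambda>m. m div Q) ` prime_products k)" using fin by blast
    ultimately show False using primes_infinite finite_subset by blast
  qed
  have div_ge: "(real N - 1) / real Q - 1 \<le> real ((N - 1) div Q)" if "N \<ge> 1" for N
  proof -
    have "real ((N - 1) div Q) = of_int \<lfloor>real (N - 1) / real Q\<rfloor>"
      by (simp add: floor_divide_of_nat_eq)
    moreover have "real (N - 1) = real N - 1" using that by simp
    ultimately show ?thesis by simp
  qed
  let ?y = "\<lambda>R::real. R powr (3/4)"
  have y: "filterlim ?y at_top at_top" by real_asymp
  \<comment> \<open>The last claim compares exponents: 3/4 times 14/15 is 7/10, while
    \<open>2/3 + \<delta>\<close> is at most 11/16.\<close>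
  have asymp: "eventually (\<lambda>R::real. real Q \<le> ?y R) at_top" "eventually (\<lambda>R::real. ?y R \<le> R) at_top"
    "eventually (\<lambda>R::real. real Q * (R powr (2/3 + \<delta>) / 4) \<le> ?y R powr (14/15)) at_top"
    using \<delta> by real_asymp+
  \<comment> \<open>Quantifying over all \<open>S\<close> keeps the threshold for \<open>R\<close>
    independent of the set of the first \<open>N\<close> terms, which is inserted later.\<close>
  have "eventually (\<lambda>R::real. \<forall>S. finite S \<longrightarrow> (\<forall>m\<in>S. m > 0) \<longrightarrow>
      (\<forall>p\<in>primes_le R. Q < p \<longrightarrow> Q * p \<in> S) \<longrightarrow>
      (\<exists>s. (\<forall>m\<in>S. s m \<in> {-1, 1 :: real}) \<and>
        \<bar>(\<Sum>m\<in>S. s m / m) - \<tau>\<bar> < exp (- (R powr (1/3 - 2 * \<delta>)) / 3))) at_top"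
    using eventually_signed_prime_reciprocals_near[OF \<delta>(1,2)]
      eventually_compose_filterlim[OF eventually_sum_prime_reciprocals_gt[of "real Q * \<bar>\<tau>\<bar>" Q] y]
      eventually_compose_filterlim[OF eventually_sum_prime_reciprocals_between_ge[of Q] y]
      asymp eventually_gt_at_top[of 0]
  proof eventually_elim
    case (elim R)
    show ?case
    proof (intro allI impI)
      fix S :: "nat set"
      assume S: "finite S" "\<forall>m\<in>S. m > 0" "\<forall>p\<in>primes_le R. Q < p \<longrightarrow> Q * p \<in> S"
      show "\<exists>s. (\<forall>m\<in>S. s m \<in> {-1, 1 :: real}) \<and>
        \<bar>(\<Sum>m\<in>S. s m / m) - \<tau>\<bar> < exp (- (R powr (1/3 - 2 * \<delta>)) / 3)"
      \<comment> \<open>Here \<open>z\<close> is chosen so that \<open>Q / z\<close> equals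
        \<open>W\<close>.\<close>
      proof (rule signed_reciprocals_near[where Q = Q and R = R and y = "?y R" and
            z = "real Q * (R powr (2/3 + \<delta>) / 4)" and W = "4 / R powr (2/3 + \<delta>)"])
        show "real Q / real m \<le> (\<Sum>p\<in>{p\<in>primes_le (?y R). m < p \<and> Q < p}. 1 / real p)"
          if "1 \<le> m" "real m \<le> real Q * (R powr (2/3 + \<delta>) / 4)" for m
          using elim(3,6) that by force
      qed (use S Q elim in auto)
    qed
  qed
  moreover have "filterlim (\<lambda>N. real ((N - 1) div Q)) at_top sequentially"
  proof (rule filterlim_at_top_mono)
    show "filterlim (\<lambda>N. (real N - 1) / real Q - 1) at_top sequentially" using Q by real_asymp
    show "eventually (\<lambda>N. (real N - 1) / real Q - 1 \<le> real ((N - 1) div Q)) sequentially"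
      using eventually_ge_at_top[of 1] by eventually_elim (rule div_ge)
  qed
  ultimately have "eventually (\<lambda>N. \<forall>S. finite S \<longrightarrow> (\<forall>m\<in>S. m > 0) \<longrightarrow>
      (\<forall>p\<in>primes_le (real ((N - 1) div Q)). Q < p \<longrightarrow> Q * p \<in> S) \<longrightarrow>
      (\<exists>s. (\<forall>m\<in>S. s m \<in> {-1, 1 :: real}) \<and>
        \<bar>(\<Sum>m\<in>S. s m / m) - \<tau>\<bar> < exp (- (real ((N - 1) div Q) powr (1/3 - 2 * \<delta>)) / 3))) sequentially"
    by (rule eventually_compose_filterlim)
  moreover have "eventually (\<lambda>N. \<bar>f N\<bar> \<le> 1 * \<bar>real N powr (1 / (2 * real k + 1) - \<epsilon>)\<bar>) sequentially"
    using landau_o.smallD[OF assms(3), of 1] by simp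
  \<comment> \<open>One more \<open>\<delta>\<close> in the exponent pays for the constants
    \<open>Q\<close> and 3.\<close>
  moreover have "eventually (\<lambda>N. real N powr (1/3 - 3 * \<delta>) \<le>
      ((real N - 1) / real Q - 1) powr (1/3 - 2 * \<delta>) / 3) sequentially"
    using \<delta> Q by real_asymp
  moreover have "eventually (\<lambda>N. N > 2 * Q) sequentially" by (rule eventually_gt_at_top)
  ultimately have "eventually (\<lambda>N. min_signed_dist (bseq k) N \<tau> < exp (- f N)) sequentially"
  proof eventually_elim
    case (elim N)
    \<comment> \<open>For \<open>p \<le> R\<close> the product \<open>Q * p\<close> is at most
      \<open>N - 1\<close>, so it occurs among the first \<open>N\<close> terms.\<close>
    define R where "R = (N - 1) div Q"
    have "\<exists>s. (\<forall>m\<in>bseq k ` {1..N}. s m \<in> {-1, 1 :: real}) \<and>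
        \<bar>(\<Sum>m\<in>bseq k ` {1..N}. s m / m) - \<tau>\<bar> < exp (- (real R powr (1/3 - 2 * \<delta>)) / 3)"
    proof (rule elim(1)[folded R_def, rule_format])
      show "m > 0" if "m \<in> bseq k ` {1..N}" for m
        using that bseq_image(2)[OF inf, of N] prime_products_pos by blast
      fix p assume p: "p \<in> primes_le (real R)" "Q < p"
      have "Q * p \<le> Q * R" using p by (intro mult_left_mono) (auto simp: primes_le_def)
      also have "\<dots> \<le> N - 1" by (simp add: R_def)
      finally have "Q * p < N" using elim by linarith
      thus "Q * p \<in> bseq k ` {1..N}"
        using p by (intro bseq_image(3)[OF inf] Qp) (auto simp: primes_le_def)
    qed auto
    then obtain s where s: "\<forall>m\<in>bseq k ` {1..N}. s m \<in> {-1, 1 :: real}"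
        "\<bar>(\<Sum>m\<in>bseq k ` {1..N}. s m / m) - \<tau>\<bar> < exp (- (real R powr (1/3 - 2 * \<delta>)) / 3)" by blast
    have "f N \<le> real N powr (1 / (2 * real k + 1) - \<epsilon>)" using elim(2) by simp
    also have "\<dots> \<le> real N powr (1/3 - 3 * \<delta>)"
      using assms(1) \<delta> elim(4) Q by (intro powr_mono diff_mono divide_left_mono) auto
    also have "\<dots> \<le> ((real N - 1) / real Q - 1) powr (1/3 - 2 * \<delta>) / 3" by (fact elim)
    also have "\<dots> \<le> real R powr (1/3 - 2 * \<delta>) / 3"
    proof (intro divide_right_mono powr_mono2)
      have "real N \<ge> 1 + Q" using elim(4) Q by linarith
      thus "0 \<le> (real N - 1) / real Q - 1" using Q by (simp add: field_simps)
      show "(real N - 1) / real Q - 1 \<le> real R"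
        using elim(4) div_ge[of N] by (simp add: R_def)
    qed (use \<delta> in auto)
    finally have "exp (- (real R powr (1/3 - 2 * \<delta>)) / 3) \<le> exp (- f N)" by simp
    thus ?case using min_signed_dist_less[OF bseq_image(1)[OF inf] s] by linarith
  qed
  thus "\<exists>N0. \<forall>N\<ge>N0. min_signed_dist (bseq k) N \<tau> < exp (- f N)"
    by (simp add: eventually_sequentially)
qed

end
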